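(* For every function $f\colon\{0,1\}^n\to\{0,1\}$, every probability distribution $\mu$ on $\{0,1\}^n$ and every integer $k\ge 1$, $$k\cdot\mathsf{disc}(f,\mu)\;\ge\;\mathsf{disc}(f^{\oplus k},\mu^k)\;\ge\; k\cdot\big(\mathsf{disc}(f,\mu)-1\big).$$
   Context: For $g\colon\{0,1\}^N\to\{0,1\}$, a probability distribution $\nu$ on $\{0,1\}^N$ and an affine subspace $S\subseteq\{0,1\}^N=\mathbb{F}_2^N$, let $\mathsf{bias}(g,\nu,S)=\left|\sum_{x\in S}(-1)^{g(x)}\nu(x)\right|$, and let $\mathsf{disc}(g,\nu)=-\log_2\max_{S}\mathsf{bias}(g,\nu,S)$, the maximum over all affine subspaces $S$ of $\{0,1\}^N$. $f^{\oplus k}\colon(\{0,1\}^n)^k\to\{0,1\}$ is $f^{\oplus k}(x^1,\dots,x^k)=f(x^1)\oplus\cdots\oplus f(x^k)$, and $\mu^k=\mu\times\cdots\times\mu$ ($k$ times). *)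

theory Defs
  imports "HOL-Analysis.Cartesian_Space" "HOL-Probability.Product_PMF" "HOL-Library.Z2"
begin

text \<open>
  \<open>{0,1}\<^sup>N = \<bbbF>\<^sub>2\<^sup>N\<close> is the type \<^typ>\<open>bit ^ 'm\<close> with \<open>N = CARD('m)\<close>. An affine subspace is
  a translate of a linear subspace over \<^typ>\<open>bit\<close>; in particular it is nonempty (admitting the
  empty set would not change the maximum below, since its bias is 0).
\<close>

definition affine_subspace :: "(bit ^ 'm) set \<Rightarrow> bool" where
  "affine_subspace S \<longleftrightarrow> (\<exists>a V. vec.subspace V \<and> S = (\<lambda>v. a + v) ` V)"

definition bias :: "(bit ^ 'm \<Rightarrow> bit) \<Rightarrow> (bit ^ 'm) pmf \<Rightarrow> (bit ^ 'm) set \<Rightarrow> real" where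
  "bias g \<nu> S = \<bar>\<Sum>x\<in>S. (-1) ^ (of_bool (g x = 1) :: nat) * pmf \<nu> x\<bar>"

definition disc :: "(bit ^ 'm \<Rightarrow> bit) \<Rightarrow> (bit ^ 'm) pmf \<Rightarrow> real" where
  "disc g \<nu> = - log 2 (Max (bias g \<nu> ` {S. affine_subspace S}))"

text \<open>
  \<open>({0,1}\<^sup>n)\<^sup>k\<close> is identified with \<open>{0,1}\<^sup>k\<^sup>n\<close> by concatenation: coordinate \<open>(i, j)\<close> is the \<open>j\<close>-th
  coordinate of the \<open>i\<close>-th block. Here \<open>k = CARD('k)\<close> and \<open>n = CARD('n)\<close>.
\<close>

definition block :: "'k \<Rightarrow> bit ^ ('k :: finite \<times> 'n :: finite) \<Rightarrow> bit ^ 'n" where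
  "block i x = (\<chi> j. x $ (i, j))"

definition concat_blocks :: "('k \<Rightarrow> bit ^ 'n) \<Rightarrow> bit ^ ('k :: finite \<times> 'n :: finite)" where
  "concat_blocks xs = (\<chi> p. xs (fst p) $ snd p)"

text \<open>Addition on \<^typ>\<open>bit\<close> is exclusive or.\<close>

definition xor_power :: "(bit ^ 'n \<Rightarrow> bit) \<Rightarrow> bit ^ ('k :: finite \<times> 'n :: finite) \<Rightarrow> bit" where
  "xor_power f x = (\<Sum>i\<in>UNIV. f (block i x))"

definition pmf_power :: "(bit ^ 'n) pmf \<Rightarrow> (bit ^ ('k :: finite \<times> 'n :: finite)) pmf" where
  "pmf_power \<mu> = map_pmf concat_blocks (Pi_pmf UNIV undefined (\<lambda>_. \<mu>))"

lemma block_concat_blocks [simp]: "block i (concat_blocks xs) = xs i"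
  by (simp add: block_def concat_blocks_def vec_eq_iff)

lemma concat_blocks_block [simp]: "concat_blocks (\<lambda>i. block i x) = x"
  by (simp add: block_def concat_blocks_def vec_eq_iff)

lemma pmf_pmf_power:
  fixes x :: "bit ^ ('k :: finite \<times> 'n :: finite)"
  shows "pmf (pmf_power \<mu>) x = (\<Prod>i\<in>UNIV. pmf \<mu> (block i x))"
proof -
  have "inj (concat_blocks :: ('k \<Rightarrow> bit ^ 'n) \<Rightarrow> _)"
    by (rule injI) (metis block_concat_blocks ext)
  then have "pmf (pmf_power \<mu>) (concat_blocks (\<lambda>i. block i x)) =
      pmf (Pi_pmf UNIV undefined (\<lambda>_. \<mu>)) (\<lambda>i. block i x)"
    unfolding pmf_power_def by (rule pmf_map_inj')
  then show ?thesis
    by (simp add: pmf_Pi)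
qed

end

theory Submission
  imports Defs
begin

text \<open>
  Write \<open>G x = (-1)\<^bsup>f x\<^esup> \<mu> x\<close> and let \<open>m\<close> be the largest bias of \<open>f\<close>. The function that
  belongs to \<open>f\<^bsup>\<oplus>k\<^esup>\<close> and \<open>\<mu>\<^bsup>k\<^esup>\<close> is the tensor power of \<open>G\<close>. Its sum over the
  power of an optimal subspace for \<open>f\<close> is \<open>m\<^bsup>k\<^esup>\<close> in absolute value, which gives the upper bound
  on the discrepancy. Conversely, the indicator of an affine subspace \<open>a + V\<close> is the average over
  \<open>w \<in> V\<^bsup>\<bottom>\<^esup>\<close> of the shifted characters \<open>(-1)\<^bsup>w \<cdot> (x - a)\<^esup>\<close>, so every bias is at most
  the largest Fourier coefficient. Fourier coefficients are multiplicative under tensor powers, and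
  a coefficient of \<open>G\<close> is a difference of sums over two parallel hyperplanes, hence at most \<open>2 m\<close>
  in absolute value.
\<close>

section \<open>Characters of a vector space over the field with two elements\<close>

text \<open>Makes \<open>bit ^ 'm\<close> finite, and with it the family of affine subspaces over
  which \<open>disc\<close> takes a maximum.\<close>

instance bit :: finite
proof
  have "(UNIV :: bit set) = {0, 1}"
    using bit.exhaust by auto
  then show "finite (UNIV :: bit set)"
    by (metis finite.emptyI finite.insertI)
qed

text \<open>The nontrivial additive character of the two-element field.\<close>

definition bit_sign :: "bit \<Rightarrow> real" where
  "bit_sign b = (-1) ^ (of_bool (b = 1) :: nat)"

lemma bit_sign_0 [simp]: "bit_sign 0 = 1"
  and bit_sign_1 [simp]: "bit_sign 1 = -1"
  by (simp_all add: bit_sign_def)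

lemma abs_bit_sign [simp]: "\<bar>bit_sign b\<bar> = 1"
  by (cases b) auto

lemma bit_sign_add: "bit_sign (a + b) = bit_sign a * bit_sign b"
  by (cases "a = 0"; cases "b = 0") auto

text \<open>The library rewrites the field operations on bits to bitwise ones, which hides ring laws.\<close>

declare add_bit_eq_xor [simp del] mult_bit_eq_and [simp del] minus_bit_def [simp del]

lemma bit_sign_diff: "bit_sign (a - b) = bit_sign a * bit_sign b"
  by (simp add: minus_bit_def bit_sign_add)

lemma bit_sign_sum: "bit_sign (sum f A) = (\<Prod>i\<in>A. bit_sign (f i))"
  by (induction A rule: infinite_finite_induct) (auto simp: bit_sign_add)

lemma scalar_product_add_left: "scalar_product (u + v) x = scalar_product u x + scalar_product v x"
  by (simp add: scalar_product_def distrib_right sum.distrib)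

lemma scalar_product_add_right: "scalar_product w (x + y) = scalar_product w x + scalar_product w y"
  by (simp add: scalar_product_def distrib_left sum.distrib)

lemma scalar_product_diff_right:
  fixes w :: "'a :: ring_1 ^ 'n"
  shows "scalar_product w (x - y) = scalar_product w x - scalar_product w y"
  by (simp add: scalar_product_def right_diff_distrib sum_subtractf)

lemma scalar_product_zero_left [simp]: "scalar_product 0 x = 0"
  and scalar_product_zero_right [simp]: "scalar_product x 0 = 0"
  by (simp_all add: scalar_product_def)

lemma scalar_product_scale_left: "scalar_product (c *s w) x = c * scalar_product w x"
  by (simp add: scalar_product_def sum_distrib_left mult.assoc)

lemma scalar_product_scale_right:
  fixes w :: "'a :: comm_semiring_1 ^ 'n"
  shows "scalar_product w (c *s x) = c * scalar_product w x"
  by (simp add: scalar_product_def sum_distrib_left mult_ac)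

text \<open>Adding some \<open>u\<close> in \<open>W\<close> with
  \<open>scalar_product u y = 1\<close> permutes \<open>W\<close> and flips every sign, so the sum
  equals its own negative.\<close>

lemma sum_bit_sign_scalar_product:
  fixes W :: "(bit ^ 'm) set"
  assumes W: "vec.subspace W"
  shows "(\<Sum>w\<in>W. bit_sign (scalar_product w y)) =
    (if \<forall>w\<in>W. scalar_product w y = 0 then real (card W) else 0)"
proof (cases "\<forall>w\<in>W. scalar_product w y = 0")
  case True
  then show ?thesis by simp
next
  case False
  then obtain u where u: "u \<in> W" "scalar_product u y = 1" by auto
  let ?s = "\<Sum>w\<in>W. bit_sign (scalar_product w y)"
  have "bij_betw (\<lambda>w. u + w) W W"
    by (rule bij_betw_byWitness[where f' = "\<lambda>w. w - u"])
      (auto intro: vec.subspace_add[OF W] vec.subspace_diff[OF W] u)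
  then have "?s = (\<Sum>w\<in>W. bit_sign (scalar_product (u + w) y))"
    by (rule sum.reindex_bij_betw[symmetric])
  also have "\<dots> = - ?s"
    by (simp add: scalar_product_add_left bit_sign_add u sum_negf)
  finally show ?thesis using False by auto
qed

lemma separating_scalar_product:
  fixes V :: "('a :: field ^ 'm) set"
  assumes V: "vec.subspace V" and x: "x \<notin> V"
  shows "\<exists>w. (\<forall>v\<in>V. scalar_product w v = 0) \<and> scalar_product w x = 1"
proof -
  obtain B where B: "B \<subseteq> V" "vec.independent B" "V \<subseteq> vec.span B"
    by (rule vec.maximal_independent_subset)
  have "x \<notin> vec.span B"
    using vec.span_minimal[OF B(1) V] x by blast
  then have "vec.independent (insert x B)"
    using B(2) by (rule vec.independent_insertI)
  \<comment> \<open>The value \<open>1\<close> is the all-ones vector, so any coordinate of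
    \<open>g\<close> is a functional that is 1 at \<open>x\<close> and 0 on \<open>B\<close>; a row
    of the matrix of \<open>g\<close> represents it.\<close>
  from vec.linear_independent_extend[OF this, where f = "\<lambda>b. if b = x then 1 else 0 :: 'a ^ 'm"]
  obtain g :: "'a ^ 'm \<Rightarrow> 'a ^ 'm" where g: "Vector_Spaces.linear (*s) (*s) g"
    "\<forall>b\<in>insert x B. g b = (if b = x then 1 else 0)" by blast
  fix i :: 'm
  define w where "w = matrix g $ i"
  have w: "scalar_product w v = g v $ i" for v
    using matrix_works[OF g(1), of v]
    by (auto simp: w_def scalar_product_def matrix_vector_mult_def vec_eq_iff)
  have "x \<notin> B" using B(1) x by blast
  then have "g b = 0" if "b \<in> B" for b
    using g(2) that by auto
  then have "g v = 0" if "v \<in> V" for v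
    using vec.linear_eq_0_on_span[OF g(1)] B(3) that by blast
  with w g(2) show ?thesis by (intro exI[of _ w]) auto
qed

text \<open>The double annihilator theorem: a point outside \<open>V\<close> is exposed by a
  separating functional.\<close>

lemma subspace_mem_iff_annihilated:
  fixes V :: "('a :: field ^ 'm) set"
  assumes V: "vec.subspace V"
  shows "x \<in> V \<longleftrightarrow> (\<forall>w. (\<forall>v\<in>V. scalar_product w v = 0) \<longrightarrow> scalar_product w x = 0)"
    (is "_ \<longleftrightarrow> ?annihilated")
proof
  assume ann: ?annihilated
  show "x \<in> V"
  proof (rule ccontr)
    assume "x \<notin> V"
    with separating_scalar_product[OF V, of x]
    obtain w where "\<forall>v\<in>V. scalar_product w v = 0" and w: "scalar_product w x = 1" by blast
    with ann have "scalar_product w x = 0" by blast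
    with w show False by simp
  qed
qed blast

section \<open>Sums over affine subspaces versus Fourier coefficients\<close>

lemma abs_sum_affine_le:
  fixes G :: "bit ^ 'm \<Rightarrow> real"
  assumes S: "affine_subspace S"
    and M: "\<And>w. \<bar>\<Sum>x\<in>UNIV. bit_sign (scalar_product w x) * G x\<bar> \<le> M"
  shows "\<bar>sum G S\<bar> \<le> M"
proof -
  obtain a V where V: "vec.subspace V" and S_eq: "S = (\<lambda>v. a + v) ` V"
    using S by (auto simp: affine_subspace_def)
  define W where "W = {w. \<forall>v\<in>V. scalar_product w v = 0}"
  have W: "vec.subspace W"
    by (rule vec.subspaceI)
      (auto simp: W_def scalar_product_add_left scalar_product_scale_left)
  have "x \<in> S \<longleftrightarrow> x - a \<in> V" for x
    unfolding S_eq by (auto intro!: image_eqI[of _ _ "x - a"])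
  then have S_iff: "x \<in> S \<longleftrightarrow> (\<forall>w\<in>W. scalar_product w (x - a) = 0)" for x
    using subspace_mem_iff_annihilated[OF V, of "x - a"] unfolding W_def by blast
  have "real (card W) * sum G S = (\<Sum>x\<in>UNIV. if x \<in> S then real (card W) * G x else 0)"
    by (simp add: sum_distrib_left sum.If_cases)
  \<comment> \<open>Orthogonality turns \<open>card W\<close> times the indicator of
    \<open>S\<close> into a sum of shifted characters.\<close>
  also have "\<dots> = (\<Sum>x\<in>UNIV. (\<Sum>w\<in>W. bit_sign (scalar_product w (x - a))) * G x)"
    by (intro sum.cong) (auto simp: sum_bit_sign_scalar_product[OF W] S_iff)
  also have "\<dots> = (\<Sum>w\<in>W. \<Sum>x\<in>UNIV. bit_sign (scalar_product w (x - a)) * G x)"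
    by (subst sum.swap) (simp add: sum_distrib_right)
  \<comment> \<open>The shift by \<open>a\<close> only contributes a sign, which disappears in
    absolute values.\<close>
  also have "\<dots> = (\<Sum>w\<in>W. bit_sign (scalar_product w a) *
      (\<Sum>x\<in>UNIV. bit_sign (scalar_product w x) * G x))"
    unfolding scalar_product_diff_right bit_sign_diff by (simp add: sum_distrib_left mult_ac)
  finally have "real (card W) * \<bar>sum G S\<bar> = \<bar>\<Sum>w\<in>W. bit_sign (scalar_product w a) *
      (\<Sum>x\<in>UNIV. bit_sign (scalar_product w x) * G x)\<bar>"
    by (metis abs_mult abs_of_nat)
  also have "\<dots> \<le> (\<Sum>w\<in>W. \<bar>bit_sign (scalar_product w a) *
      (\<Sum>x\<in>UNIV. bit_sign (scalar_product w x) * G x)\<bar>)"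
    by (rule sum_abs)
  also have "\<dots> \<le> real (card W) * M"
    by (rule sum_bounded_above) (simp add: abs_mult M)
  finally have "real (card W) * \<bar>sum G S\<bar> \<le> real (card W) * M" .
  moreover have "card W > 0"
    using vec.subspace_0[OF W] by (auto simp: card_gt_0_iff)
  ultimately show ?thesis by simp
qed

lemma affine_subspace_singleton: "affine_subspace {x}"
  unfolding affine_subspace_def
  by (intro exI[of _ x] exI[of _ "{0}"]) auto

text \<open>The point \<open>a\<close> guarantees nonemptiness, which fails for \<open>w = 0\<close>
  and \<open>c = 1\<close>.\<close>

lemma affine_subspace_hyperplane:
  assumes "scalar_product w a = c"
  shows "affine_subspace {x. scalar_product w x = c}"
proof -
  have "vec.subspace {x. scalar_product w x = 0}"
    by (rule vec.subspaceI) (auto simp: scalar_product_add_right scalar_product_scale_right)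
  moreover have "{x. scalar_product w x = c} = (\<lambda>v. a + v) ` {x. scalar_product w x = 0}"
  proof (intro equalityI subsetI)
    fix x assume "x \<in> {x. scalar_product w x = c}"
    then show "x \<in> (\<lambda>v. a + v) ` {x. scalar_product w x = 0}"
      using assms by (intro image_eqI[of _ _ "x - a"]) (auto simp: scalar_product_diff_right)
  qed (use assms in \<open>auto simp: scalar_product_add_right\<close>)
  ultimately show ?thesis unfolding affine_subspace_def by blast
qed

lemma abs_fourier_le:
  fixes G :: "bit ^ 'm \<Rightarrow> real"
  assumes m: "\<And>S. affine_subspace S \<Longrightarrow> \<bar>sum G S\<bar> \<le> m"
  shows "\<bar>\<Sum>x\<in>UNIV. bit_sign (scalar_product w x) * G x\<bar> \<le> 2 * m"
proof -
  let ?H = "\<lambda>c. {x. scalar_product w x = c}"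
  have H0: "\<bar>sum G (?H 0)\<bar> \<le> m"
    by (rule m, rule affine_subspace_hyperplane[of _ 0]) simp
  have H1: "\<bar>sum G (?H 1)\<bar> \<le> m"
  proof (cases "?H 1 = {}")
    \<comment> \<open>This happens for \<open>w = 0\<close>. The empty sum is 0, and
      \<open>H0\<close> supplies \<open>0 \<le> m\<close>.\<close>
    case True
    then show ?thesis unfolding True using H0 by simp
  next
    case False
    then show ?thesis by (auto intro: m affine_subspace_hyperplane)
  qed
  have "(\<Sum>x\<in>UNIV. bit_sign (scalar_product w x) * G x) =
      (\<Sum>x\<in>?H 0 \<union> ?H 1. bit_sign (scalar_product w x) * G x)"
    by (rule sum.cong) auto
  also have "\<dots> = sum G (?H 0) - sum G (?H 1)"
    by (subst sum.union_disjoint) (auto simp: sum_negf)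
  finally show ?thesis using H0 H1 by linarith
qed

section \<open>Concatenation of blocks\<close>

text \<open>Distributivity, transported along the bijection between vectors and families of blocks.
  The factor \<open>h\<close> may vary with \<open>i\<close> because the blocks of a frequency
  vector differ.\<close>

lemma sum_prod_blocks:
  fixes h :: "'k :: finite \<Rightarrow> bit ^ 'n \<Rightarrow> 'a :: comm_semiring_1"
  shows "(\<Sum>x | \<forall>i. block i x \<in> S i. \<Prod>i\<in>UNIV. h i (block i x)) = (\<Prod>i\<in>UNIV. \<Sum>y\<in>S i. h i y)"
proof -
  have "(\<Prod>i\<in>UNIV. \<Sum>y\<in>S i. h i y) = (\<Sum>xs\<in>Pi\<^sub>E UNIV S. \<Prod>i\<in>UNIV. h i (xs i))"
    by (rule prod_sum_PiE) auto
  also have "\<dots> = (\<Sum>x | \<forall>i. block i x \<in> S i. \<Prod>i\<in>UNIV. h i (block i x))"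
    by (rule sum.reindex_bij_witness[where i = "\<lambda>x i. block i x" and j = concat_blocks]) auto
  finally show ?thesis ..
qed

text \<open>The direction spaces combine to a product subspace, which the concatenated base points
  translate.\<close>

lemma affine_subspace_blocks:
  fixes S :: "'k :: finite \<Rightarrow> (bit ^ 'n) set"
  assumes "\<And>i. affine_subspace (S i)"
  shows "affine_subspace {x. \<forall>i. block i x \<in> S i}"
proof -
  obtain a V where V: "\<And>i. vec.subspace (V i)" and S: "\<And>i. S i = (\<lambda>v. a i + v) ` V i"
    using assms unfolding affine_subspace_def by metis
  have add: "block i (x + y) = block i x + block i y"
    and scale: "block i (c *s x) = c *s block i x"
    and diff: "block i (x - y) = block i x - block i y"
    and zero: "block i 0 = 0"
    for i :: 'k and x y :: "bit ^ ('k \<times> 'n)" and c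
    by (simp_all add: block_def vec_eq_iff)
  have S_iff: "y \<in> S i \<longleftrightarrow> y - a i \<in> V i" for y i
    unfolding S by (auto intro!: image_eqI[of _ _ "y - a i"])
  have "vec.subspace {x :: bit ^ ('k \<times> 'n). \<forall>i. block i x \<in> V i}"
    by (rule vec.subspaceI)
      (auto simp: add scale zero intro: vec.subspace_0 vec.subspace_add vec.subspace_scale V)
  moreover have "{x. \<forall>i. block i x \<in> S i} =
      (\<lambda>v. concat_blocks a + v) ` {x. \<forall>i. block i x \<in> V i}"
  proof (intro equalityI subsetI)
    fix x assume "x \<in> {x. \<forall>i. block i x \<in> S i}"
    then show "x \<in> (\<lambda>v. concat_blocks a + v) ` {x. \<forall>i. block i x \<in> V i}"
      by (intro image_eqI[of _ _ "x - concat_blocks a"]) (simp_all add: diff S_iff)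
  qed (auto simp: add S)
  ultimately show ?thesis unfolding affine_subspace_def by blast
qed

lemma scalar_product_blocks:
  "scalar_product w x = (\<Sum>i\<in>UNIV. scalar_product (block i w) (block i x))"
  unfolding scalar_product_def block_def
  by (simp only: vec_lambda_beta sum.cartesian_product UNIV_Times_UNIV case_prod_unfold prod.collapse)

text \<open>A character factors over the blocks, so the coefficient at \<open>w\<close> is the
  product of the coefficients of \<open>G\<close> at the blocks of \<open>w\<close>.\<close>

lemma abs_fourier_prod_blocks_le:
  fixes G :: "bit ^ 'n \<Rightarrow> real" and w :: "bit ^ ('k :: finite \<times> 'n)"
  assumes M: "\<And>u. \<bar>\<Sum>y\<in>UNIV. bit_sign (scalar_product u y) * G y\<bar> \<le> M"
  shows "\<bar>\<Sum>x\<in>UNIV. bit_sign (scalar_product w x) * (\<Prod>i\<in>UNIV. G (block i x))\<bar> \<le> M ^ CARD('k)"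
proof -
  have "(\<Sum>x\<in>UNIV. bit_sign (scalar_product w x) * (\<Prod>i\<in>UNIV. G (block i x))) =
      (\<Sum>x\<in>UNIV. \<Prod>i\<in>UNIV. bit_sign (scalar_product (block i w) (block i x)) * G (block i x))"
    by (simp add: scalar_product_blocks[of w] bit_sign_sum prod.distrib)
  also have "\<dots> = (\<Prod>i\<in>UNIV. \<Sum>y\<in>UNIV. bit_sign (scalar_product (block i w) y) * G y)"
    using sum_prod_blocks[where S = "\<lambda>_. UNIV"
        and h = "\<lambda>i y. bit_sign (scalar_product (block i w) y) * G y"]
    by simp
  also have "\<bar>\<dots>\<bar> \<le> (\<Prod>i\<in>(UNIV :: 'k set). M)"
    unfolding abs_prod by (intro prod_mono) (simp add: M)
  finally show ?thesis by simp
qed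

section \<open>Bias of the exclusive or of independent copies\<close>

lemma bias_eq: "bias g \<nu> S = \<bar>\<Sum>x\<in>S. bit_sign (g x) * pmf \<nu> x\<bar>"
  by (simp add: bias_def bit_sign_def)

lemma bit_sign_xor_power_mult_pmf_power:
  "bit_sign (xor_power f x) * pmf (pmf_power \<mu>) x =
    (\<Prod>i\<in>UNIV. bit_sign (f (block i x)) * pmf \<mu> (block i x))"
  by (simp add: xor_power_def pmf_pmf_power bit_sign_sum prod.distrib)

lemma bias_blocks:
  "bias (xor_power f) (pmf_power \<mu>) {x :: bit ^ ('k :: finite \<times> 'n :: finite). \<forall>i. block i x \<in> S} =
    bias f \<mu> S ^ CARD('k)"
  unfolding bias_eq bit_sign_xor_power_mult_pmf_power
  by (subst sum_prod_blocks[where h = "\<lambda>_ y. bit_sign (f y) * pmf \<mu> y"]) (simp add: power_abs)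

text \<open>Each of the \<open>CARD('k)\<close> factors of a Fourier coefficient is at most
  \<open>2 * m\<close>, and these coefficients bound the bias.\<close>

lemma bias_xor_power_le:
  fixes S :: "(bit ^ ('k :: finite \<times> 'n :: finite)) set"
  assumes m: "\<And>T. affine_subspace T \<Longrightarrow> bias f \<mu> T \<le> m" and S: "affine_subspace S"
  shows "bias (xor_power f) (pmf_power \<mu>) S \<le> (2 * m) ^ CARD('k)"
  unfolding bias_eq bit_sign_xor_power_mult_pmf_power using m
  by (intro abs_sum_affine_le[OF S] abs_fourier_le
      abs_fourier_prod_blocks_le[where G = "\<lambda>y. bit_sign (f y) * pmf \<mu> y"])
    (simp add: bias_eq)

theorem lemma7:
  fixes f :: "bit ^ 'n \<Rightarrow> bit" and \<mu> :: "(bit ^ 'n) pmf"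
  shows "real CARD('k) * disc f \<mu>
           \<ge> disc (xor_power f :: bit ^ ('k :: finite \<times> 'n) \<Rightarrow> bit) (pmf_power \<mu>)
       \<and> disc (xor_power f :: bit ^ ('k \<times> 'n) \<Rightarrow> bit) (pmf_power \<mu>)
           \<ge> real CARD('k) * (disc f \<mu> - 1)"
proof -
  define m where "m = Max (bias f \<mu> ` {S. affine_subspace S})"
  define M where "M = Max (bias (xor_power f) (pmf_power \<mu>) `
    {S :: (bit ^ ('k \<times> 'n)) set. affine_subspace S})"
  have le_m: "bias f \<mu> S \<le> m" if "affine_subspace S" for S
    unfolding m_def using that by (intro Max_ge) auto
  have "m \<in> bias f \<mu> ` {S. affine_subspace S}"
    unfolding m_def using affine_subspace_singleton by (intro Max_in) auto
  then obtain S where S: "affine_subspace S" "m = bias f \<mu> S" by auto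
  \<comment> \<open>A singleton in the support has positive bias, so the logarithms below have
    positive arguments.\<close>
  obtain x where "x \<in> set_pmf \<mu>"
    using set_pmf_not_empty[of \<mu>] by blast
  then have "0 < bias f \<mu> {x}"
    by (simp add: bias_eq abs_mult pmf_positive)
  also have "\<dots> \<le> m" by (rule le_m[OF affine_subspace_singleton])
  finally have m_pos: "m > 0" .
  \<comment> \<open>The product of copies of the optimal \<open>S\<close> competes in the maximum
    \<open>M\<close>.\<close>
  have lower: "m ^ CARD('k) \<le> M"
    unfolding S(2) bias_blocks[symmetric, where 'k = 'k] M_def
    using affine_subspace_blocks[of "\<lambda>_ :: 'k. S", OF S(1)] by (intro Max_ge) auto
  have upper: "M \<le> (2 * m) ^ CARD('k)"
    unfolding M_def using affine_subspace_singleton bias_xor_power_le[OF le_m]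
    by (subst Max_le_iff) auto
  have M_pos: "M > 0"
    using lower m_pos by (meson less_le_trans zero_less_power)
  have "real CARD('k) * log 2 m \<le> log 2 M"
    using lower m_pos M_pos by (simp flip: log_nat_power)
  \<comment> \<open>The factor 2 per block becomes the loss of 1 in each copy of the
    discrepancy.\<close>
  moreover have "log 2 M \<le> log 2 ((2 * m) ^ CARD('k))"
    using upper m_pos M_pos by simp
  then have "log 2 M \<le> real CARD('k) * (1 + log 2 m)"
    using m_pos by (simp add: log_nat_power log_mult distrib_left)
  ultimately show ?thesis
    unfolding disc_def m_def[symmetric] M_def[symmetric] by (simp add: algebra_simps)
qed

end
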